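(* Let $(\Omega,\Sigma,P_{\mathbb{D}})$ be a $\mathbb{D}$-probabilistic space, let $\mathbb{P}=\{A_n \mid n\in\mathbb{N}\}\subset\Sigma$ be a partition of $\Omega$ with $P_{\mathbb{D}}(A_n)\succ 0$ for every $n$, and let $X_{\mathbb{D}}$ be a $\mathbb{D}$-random variable with $E(|X_{\mathbb{D}}|_k)\prec\infty$ (that is, $X_{\mathbb{D}}$ is integrable). Then for every set $A$ of the form $A=\bigcup_{j\in J}A_j$ with $J\subset\mathbb{N}$, $$\int_{A}E_{\mathbb{P}}(X_{\mathbb{D}})\,dP_{\mathbb{D}}=\int_{A}X_{\mathbb{D}}\,dP_{\mathbb{D}} .$$
   Context: The hyperbolic numbers are the commutative ring $\mathbb{D}=\{a+bk \mid a,b\in\mathbb{R},\ k^2=1,\ k\notin\mathbb{R}\}$. Put $e=\frac{1+k}{2}$, $e^{\dagger}=\frac{1-k}{2}$ (so $e^2=e$, $(e^\dagger)^2=e^\dagger$, $ee^\dagger=0$, $e+e^\dagger=1$); every $z=a+bk$ is uniquely $z=v_1e+v_2e^{\dagger}$ with $v_1=a+b$, $v_2=a-b\in\mathbb{R}$, and all algebraic operations are componentwise in $(v_1,v_2)$. The hyperbolic modulus is $|v_1e+v_2e^\dagger|_k=|v_1|e+|v_2|e^\dagger$. Let $\mathbb{D}^+=\{v_1e+v_2e^\dagger \mid v_1,v_2\ge 0\}$; write $z_1\preceq z_2$ if $z_2-z_1\in\mathbb{D}^+$, and $z_1\prec z_2$ if moreover $z_1\neq z_2$. $\mathfrak{S}_{\mathbb{D}}$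 is the set of zero divisors of $\mathbb{D}$, i.e. the nonzero real multiples of $e$ and of $e^\dagger$. The topology on $\mathbb{D}$ is the usual topology of $\mathbb{R}^2$ in the coordinates $(v_1,v_2)$. A $\mathbb{D}$-probabilistic space $(\Omega,\Sigma,P_{\mathbb{D}})$ is a measurable space $(\Omega,\Sigma)$ with a function $P_{\mathbb{D}}\colon\Sigma\to\mathbb{D}$ such that $P_{\mathbb{D}}(A)\succeq 0$ for all $A\in\Sigma$, $P_{\mathbb{D}}(\Omega)\in\{1,e,e^\dagger\}$, and $P_{\mathbb{D}}$ is countably additive on pairwise disjoint sequences in $\Sigma$. Write $P_{\mathbb{D}}=P_1e+P_2e^\dagger$; $P_1,P_2$ are ordinary real measures on $\Sigma$ (each a probability measure or zero). A $\mathbb{D}$-random variable is a function $X_{\mathbb{D}}\colon\Omega\to\mathbb{D}$ with $X_{\mathbb{D}}^{-1}(U)\in\Sigma$ for every open $U\subset\mathbb{D}$; equivalently $X_{\mathbb{D}}=eX_1+e^\dagger X_2$ with $X_1,X_2$ real measurable functions. It is integrable if $X_1$ is Lebesgue integrable with respect to $P_1$ and $X_2$ with respect to $P_2$; then $\int_B X_{\mathbb{D}}\,dP_{\mathbb{D}}=e\int_B X_1\,dP_1+e^\dagger\int_B X_2\,dP_2$ for $B\in\Sigma$, and $E(X_{\mathbb{D}})=\int_\Omega X_{\mathbb{D}}\,dP_{\mathbb{D}}$. The conditional expectation of $X_{\mathbb{D}}$ given an event $B\in\Sigma$ is $$E_B(X_{\mathbb{D}})=\begin{cases}\dfrac{1}{P_{\mathbb{D}}(B)}\displaystyle\int_B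 X_{\mathbb{D}}\,dP_{\mathbb{D}} & \text{if } P_{\mathbb{D}}(B)\succ0,\ P_{\mathbb{D}}(B)\notin\mathfrak{S}_{\mathbb{D}},\\[2mm] E(X_{\mathbb{D}}) & \text{if } P_{\mathbb{D}}(B)=0,\\[1mm] \dfrac{1}{\lambda_1}\Big(\displaystyle\int_B X_{\mathbb{D}}\,dP_{\mathbb{D}}\Big)e+E(X_{\mathbb{D}})e^\dagger & \text{if } P_{\mathbb{D}}(B)=\lambda_1e,\ \lambda_1>0,\\[2mm] E(X_{\mathbb{D}})e+\dfrac{1}{\lambda_2}\Big(\displaystyle\int_B X_{\mathbb{D}}\,dP_{\mathbb{D}}\Big)e^\dagger & \text{if } P_{\mathbb{D}}(B)=\lambda_2e^\dagger,\ \lambda_2>0.\end{cases}$$ The conditional expectation given the partition $\mathbb{P}=\{A_n\mid n\in\mathbb{N}\}$ is the countably valued function $E_{\mathbb{P}}(X_{\mathbb{D}})=\sum_{n=1}^\infty E_{A_n}(X_{\mathbb{D}})\,\chi_{A_n}$ on $\Omega$, where $\chi_{A}$ is the usual $\{0,1\}$-valued indicator function of $A$. *)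

theory Defs
  imports "HOL-Analysis.Analysis"
begin

section \<open>Hyperbolic numbers\<close>

text \<open>\<open>Hyp a b\<close> stands for \<open>a + b k\<close>, where \<open>k\<^sup>2 = 1\<close>.\<close>

datatype hyp = Hyp (hre: real) (him: real)

lemma hyp_eq_iff: "z = w \<longleftrightarrow> hre z = hre w \<and> him z = him w"
  by (cases z; cases w) auto

text \<open>The idempotent coordinates: \<open>z = v1 z e + v2 z e\<^sup>\<dagger>\<close>, see \<open>hyp_idempotent_repr\<close> below.\<close>

definition v1 :: "hyp \<Rightarrow> real" where "v1 z = hre z + him z"
definition v2 :: "hyp \<Rightarrow> real" where "v2 z = hre z - him z"

lemma hyp_eq_iff_v: "z = w \<longleftrightarrow> v1 z = v1 w \<and> v2 z = v2 w"
  by (auto simp: hyp_eq_iff v1_def v2_def)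

instantiation hyp :: comm_ring_1
begin
definition "0 = Hyp 0 0"
definition "1 = Hyp 1 0"
definition "z + w = Hyp (hre z + hre w) (him z + him w)"
definition "z - w = Hyp (hre z - hre w) (him z - him w)"
definition "- z = Hyp (- hre z) (- him z)"
definition "z * w = Hyp (hre z * hre w + him z * him w) (hre z * him w + him z * hre w)"
instance
  by standard
    (simp_all add: hyp_eq_iff zero_hyp_def one_hyp_def plus_hyp_def minus_hyp_def uminus_hyp_def
      times_hyp_def algebra_simps)
end

instantiation hyp :: real_algebra_1
begin
definition "scaleR r z = Hyp (r * hre z) (r * him z)"
instance
  by standard
    (simp_all add: hyp_eq_iff scaleR_hyp_def plus_hyp_def times_hyp_def algebra_simps)
end

lemma v_simps [simp]:
  "v1 0 = 0" "v2 0 = 0" "v1 1 = 1" "v2 1 = 1"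
  "v1 (z + w) = v1 z + v1 w" "v2 (z + w) = v2 z + v2 w"
  "v1 (z - w) = v1 z - v1 w" "v2 (z - w) = v2 z - v2 w"
  "v1 (- z) = - v1 z" "v2 (- z) = - v2 z"
  "v1 (z * w) = v1 z * v1 w" "v2 (z * w) = v2 z * v2 w"
  "v1 (r *\<^sub>R z) = r * v1 z" "v2 (r *\<^sub>R z) = r * v2 z"
  by (simp_all add: v1_def v2_def zero_hyp_def one_hyp_def plus_hyp_def minus_hyp_def
      uminus_hyp_def times_hyp_def scaleR_hyp_def algebra_simps)

text \<open>The multiplicative inverse \<open>(a - b k) / (a\<^sup>2 - b\<^sup>2)\<close>; it has its intended meaning only on
  invertible elements (\<open>hyp_mult_inverse\<close>) and is \<open>0\<close> on \<open>0\<close> and on zero divisors.\<close>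

instantiation hyp :: inverse
begin
definition "inverse z = (1 / ((hre z)\<^sup>2 - (him z)\<^sup>2)) *\<^sub>R Hyp (hre z) (- him z)"
definition "z div w = z * inverse (w :: hyp)"
instance ..
end

text \<open>Any norm in the coordinates \<open>(v1, v2)\<close> induces the topology of the plane; the Euclidean one
  is chosen here.\<close>

instantiation hyp :: real_normed_vector
begin
definition "norm z = norm (v1 z, v2 z)"
definition "dist z w = norm (z - w :: hyp)"
definition "sgn z = z /\<^sub>R norm (z :: hyp)"
definition [code del]: "uniformity = (INF e\<in>{0 <..}. principal {(x :: hyp, y). dist x y < e})"
definition [code del]: "open (U :: hyp set) \<longleftrightarrow>
  (\<forall>x\<in>U. eventually (\<lambda>(x', y). x' = x \<longrightarrow> y \<in> U) uniformity)"
instance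
proof
  fix r :: real and x y :: hyp and U :: "hyp set"
  show "dist x y = norm (x - y)" by (rule dist_hyp_def)
  show "sgn x = x /\<^sub>R norm x" by (rule sgn_hyp_def)
  show "uniformity = (INF e\<in>{0 <..}. principal {(x :: hyp, y). dist x y < e})"
    by (rule uniformity_hyp_def)
  show "open U \<longleftrightarrow> (\<forall>x\<in>U. eventually (\<lambda>(x', y). x' = x \<longrightarrow> y \<in> U) uniformity)"
    by (rule open_hyp_def)
  show "norm x = 0 \<longleftrightarrow> x = 0"
    by (simp add: norm_hyp_def hyp_eq_iff_v zero_prod_def)
  show "norm (x + y) \<le> norm x + norm y"
    using norm_triangle_ineq[of "(v1 x, v2 x)" "(v1 y, v2 y)"] by (simp add: norm_hyp_def)
  show "norm (r *\<^sub>R x) = \<bar>r\<bar> * norm x"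
    using norm_scaleR[of r "(v1 x, v2 x)"] by (simp add: norm_hyp_def)
qed
end

lemma open_hyp_iff: "open U \<longleftrightarrow> open ((\<lambda>z. (v1 z, v2 z)) ` U)"
proof -
  have surj: "\<exists>z. (v1 z, v2 z) = y" for y
    by (rule exI[of _ "Hyp ((fst y + snd y) / 2) ((fst y - snd y) / 2)"])
       (simp add: v1_def v2_def field_simps prod_eq_iff)
  have d: "dist (v1 x, v2 x) (v1 y, v2 y) = dist x y" for x y
    by (simp add: dist_hyp_def norm_hyp_def dist_norm[of "(v1 x, v2 x)"])
  show ?thesis
  proof
    assume U: "open U"
    show "open ((\<lambda>z. (v1 z, v2 z)) ` U)"
      unfolding open_dist
    proof safe
      fix x assume "x \<in> U"
      then obtain r where r: "r > 0" "\<And>y. dist y x < r \<Longrightarrow> y \<in> U"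
        using U unfolding open_dist by blast
      show "\<exists>r>0. \<forall>y. dist y (v1 x, v2 x) < r \<longrightarrow> y \<in> (\<lambda>z. (v1 z, v2 z)) ` U"
      proof (intro exI[of _ r] conjI allI impI)
        fix y assume y: "dist y (v1 x, v2 x) < r"
        obtain z where z: "(v1 z, v2 z) = y" using surj by blast
        have "z \<in> U" using y r(2)[of z] d[of z x] z by simp
        then show "y \<in> (\<lambda>z. (v1 z, v2 z)) ` U" using z by blast
      qed (fact r(1))
    qed
  next
    assume U: "open ((\<lambda>z. (v1 z, v2 z)) ` U)"
    show "open U"
      unfolding open_dist
    proof
      fix x assume "x \<in> U"
      then have "(v1 x, v2 x) \<in> (\<lambda>z. (v1 z, v2 z)) ` U" by blast
      then obtain r where r: "r > 0"
        "\<And>y. dist y (v1 x, v2 x) < r \<Longrightarrow> y \<in> (\<lambda>z. (v1 z, v2 z)) ` U"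
        using U unfolding open_dist by blast
      show "\<exists>r>0. \<forall>y. dist y x < r \<longrightarrow> y \<in> U"
      proof (intro exI[of _ r] conjI allI impI)
        fix y assume "dist y x < r"
        then have "(v1 y, v2 y) \<in> (\<lambda>z. (v1 z, v2 z)) ` U" using r(2) d by simp
        then show "y \<in> U" by (auto dest: hyp_eq_iff_v[THEN iffD2, OF conjI])
      qed (fact r(1))
    qed
  qed
qed

definition hk :: hyp where "hk = Hyp 0 1"
definition he :: hyp where "he = (1 / 2) *\<^sub>R (1 + hk)"
definition hed :: hyp where "hed = (1 / 2) *\<^sub>R (1 - hk)"

lemma hk_square: "hk * hk = 1"
  by (simp add: hk_def times_hyp_def one_hyp_def)

lemma Hyp_eq: "Hyp a b = of_real a + of_real b * hk"
  by (simp add: of_real_def hk_def times_hyp_def one_hyp_def plus_hyp_def scaleR_hyp_def)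

lemma v_idempotents [simp]: "v1 he = 1" "v2 he = 0" "v1 hed = 0" "v2 hed = 1"
  by (simp_all add: v1_def v2_def he_def hed_def hk_def one_hyp_def plus_hyp_def minus_hyp_def
      scaleR_hyp_def)

lemma hyp_idempotent_repr: "z = v1 z *\<^sub>R he + v2 z *\<^sub>R hed"
  by (simp add: hyp_eq_iff_v)

definition hyp_nonneg :: "hyp set"  ("\<D>\<^sup>+")
  where "\<D>\<^sup>+ = {r *\<^sub>R he + s *\<^sub>R hed | r s. 0 \<le> r \<and> 0 \<le> s}"

lemma hyp_nonneg_iff: "z \<in> \<D>\<^sup>+ \<longleftrightarrow> 0 \<le> v1 z \<and> 0 \<le> v2 z"
  by (auto simp: hyp_nonneg_def hyp_eq_iff_v)

instantiation hyp :: order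
begin
definition "z \<le> w \<longleftrightarrow> w - z \<in> \<D>\<^sup>+"
definition "z < w \<longleftrightarrow> z \<le> w \<and> z \<noteq> (w :: hyp)"
instance
  by standard (auto simp: less_eq_hyp_def less_hyp_def hyp_nonneg_iff hyp_eq_iff_v)
end

definition zero_divisors :: "hyp set"  ("\<SS>\<^sub>\<D>")
  where "\<SS>\<^sub>\<D> = {r *\<^sub>R he | r. r \<noteq> 0} \<union> {r *\<^sub>R hed | r. r \<noteq> 0}"

lemma zero_divisors_iff: "z \<in> \<SS>\<^sub>\<D> \<longleftrightarrow> z \<noteq> 0 \<and> (\<exists>w. w \<noteq> 0 \<and> z * w = 0)"
proof
  assume "z \<in> \<SS>\<^sub>\<D>"
  then have "z \<noteq> 0 \<and> (z * he = 0 \<or> z * hed = 0)"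
    by (auto simp: zero_divisors_def hyp_eq_iff_v)
  moreover have "he \<noteq> 0" "hed \<noteq> 0"
    by (simp_all add: hyp_eq_iff_v)
  ultimately show "z \<noteq> 0 \<and> (\<exists>w. w \<noteq> 0 \<and> z * w = 0)" by blast
next
  assume "z \<noteq> 0 \<and> (\<exists>w. w \<noteq> 0 \<and> z * w = 0)"
  then have "(v1 z \<noteq> 0 \<and> v2 z = 0) \<or> (v1 z = 0 \<and> v2 z \<noteq> 0)"
    by (auto simp: hyp_eq_iff_v)
  then show "z \<in> \<SS>\<^sub>\<D>"
    using hyp_idempotent_repr[of z] by (auto simp: zero_divisors_def)
qed

lemma hyp_mult_inverse:
  assumes "z \<noteq> 0" "z \<notin> \<SS>\<^sub>\<D>"
  shows "z * inverse z = 1"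
proof -
  have "z = v1 z *\<^sub>R he + v2 z *\<^sub>R hed" by (rule hyp_idempotent_repr)
  then have "v1 z \<noteq> 0" "v2 z \<noteq> 0"
    using assms by (auto simp: zero_divisors_def)
  moreover have "(hre z)\<^sup>2 - (him z)\<^sup>2 = v1 z * v2 z"
    by (simp add: v1_def v2_def power2_eq_square algebra_simps)
  ultimately show ?thesis
    by (simp add: inverse_hyp_def hyp_eq_iff_v) (simp add: v1_def v2_def)
qed


section \<open>Hyperbolic-valued probability\<close>

locale hyp_prob_space = sigma_algebra \<Omega> \<Sigma> for \<Omega> :: "'a set" and \<Sigma> :: "'a set set" +
  fixes P :: "'a set \<Rightarrow> hyp"
  assumes P_nonneg: "C \<in> \<Sigma> \<Longrightarrow> 0 \<le> P C"
    and P_total: "P \<Omega> \<in> {1, he, hed}"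
    and P_countably_additive: "range B \<subseteq> \<Sigma> \<Longrightarrow> disjoint_family B \<Longrightarrow>
      (\<lambda>n. P (B n)) sums P (\<Union>n. B (n :: nat))"

definition comp_measure1 :: "'a set \<Rightarrow> 'a set set \<Rightarrow> ('a set \<Rightarrow> hyp) \<Rightarrow> 'a measure"
  where "comp_measure1 \<Omega> \<Sigma> P = measure_of \<Omega> \<Sigma> (\<lambda>B. ennreal (v1 (P B)))"

definition comp_measure2 :: "'a set \<Rightarrow> 'a set set \<Rightarrow> ('a set \<Rightarrow> hyp) \<Rightarrow> 'a measure"
  where "comp_measure2 \<Omega> \<Sigma> P = measure_of \<Omega> \<Sigma> (\<lambda>B. ennreal (v2 (P B)))"

definition hyp_random_variable :: "'a set \<Rightarrow> 'a set set \<Rightarrow> ('a \<Rightarrow> hyp) \<Rightarrow> bool"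
  where "hyp_random_variable \<Omega> \<Sigma> X \<longleftrightarrow> (\<forall>U. open U \<longrightarrow> X -` U \<inter> \<Omega> \<in> \<Sigma>)"

definition hyp_integrable ::
    "'a set \<Rightarrow> 'a set set \<Rightarrow> ('a set \<Rightarrow> hyp) \<Rightarrow> ('a \<Rightarrow> hyp) \<Rightarrow> bool"
  where "hyp_integrable \<Omega> \<Sigma> P X \<longleftrightarrow>
    integrable (comp_measure1 \<Omega> \<Sigma> P) (\<lambda>\<omega>. v1 (X \<omega>)) \<and>
    integrable (comp_measure2 \<Omega> \<Sigma> P) (\<lambda>\<omega>. v2 (X \<omega>))"

definition hyp_integral ::
    "'a set \<Rightarrow> 'a set set \<Rightarrow> ('a set \<Rightarrow> hyp) \<Rightarrow> 'a set \<Rightarrow> ('a \<Rightarrow> hyp) \<Rightarrow> hyp"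
  where "hyp_integral \<Omega> \<Sigma> P B X =
    (LINT \<omega>:B|comp_measure1 \<Omega> \<Sigma> P. v1 (X \<omega>)) *\<^sub>R he +
    (LINT \<omega>:B|comp_measure2 \<Omega> \<Sigma> P. v2 (X \<omega>)) *\<^sub>R hed"

definition hyp_expectation ::
    "'a set \<Rightarrow> 'a set set \<Rightarrow> ('a set \<Rightarrow> hyp) \<Rightarrow> ('a \<Rightarrow> hyp) \<Rightarrow> hyp"
  where "hyp_expectation \<Omega> \<Sigma> P X = hyp_integral \<Omega> \<Sigma> P \<Omega> X"

text \<open>In the last two cases \<open>P B = r e\<close> resp.\ \<open>P B = r e\<^sup>\<dagger>\<close> with \<open>r > 0\<close>, so that \<open>r\<close> is \<open>v1 (P B)\<close>
  resp.\ \<open>v2 (P B)\<close>. For \<open>P B \<succeq> 0\<close> the four cases are exhaustive and mutually exclusive.\<close>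

definition cond_exp_event ::
    "'a set \<Rightarrow> 'a set set \<Rightarrow> ('a set \<Rightarrow> hyp) \<Rightarrow> 'a set \<Rightarrow> ('a \<Rightarrow> hyp) \<Rightarrow> hyp"
  where "cond_exp_event \<Omega> \<Sigma> P B X =
    (if P B > 0 \<and> P B \<notin> \<SS>\<^sub>\<D> then
       (1 / P B) * hyp_integral \<Omega> \<Sigma> P B X
     else if P B = 0 then
       hyp_expectation \<Omega> \<Sigma> P X
     else if \<exists>r>0. P B = r *\<^sub>R he then
       (1 / v1 (P B)) *\<^sub>R hyp_integral \<Omega> \<Sigma> P B X * he + hyp_expectation \<Omega> \<Sigma> P X * hed
     else
       hyp_expectation \<Omega> \<Sigma> P X * he + (1 / v2 (P B)) *\<^sub>R hyp_integral \<Omega> \<Sigma> P B X * hed)"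

definition cond_exp_partition ::
    "'a set \<Rightarrow> 'a set set \<Rightarrow> ('a set \<Rightarrow> hyp) \<Rightarrow> (nat \<Rightarrow> 'a set) \<Rightarrow> ('a \<Rightarrow> hyp) \<Rightarrow> 'a \<Rightarrow> hyp"
  where "cond_exp_partition \<Omega> \<Sigma> P A X \<omega> =
    (\<Sum>n. cond_exp_event \<Omega> \<Sigma> P (A n) X * indicator (A n) \<omega>)"

lemma bounded_linear_v: "bounded_linear v1" "bounded_linear v2"
proof -
  have "\<bar>v1 z\<bar> \<le> norm z" "\<bar>v2 z\<bar> \<le> norm z" for z
    unfolding norm_hyp_def norm_prod_def
    by (simp_all add: real_le_rsqrt)
  then show "bounded_linear v1" "bounded_linear v2"
    by (auto intro!: bounded_linear_intro[where K = 1])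
qed

context hyp_prob_space
begin

lemma P_empty: "P {} = 0"
proof -
  have "(\<lambda>n :: nat. P {}) sums P {}"
    using P_countably_additive[of "\<lambda>_. {}"] by (simp add: disjoint_family_on_def)
  then have "(\<lambda>n :: nat. P {}) \<longlonglongrightarrow> 0"
    using sums_summable summable_LIMSEQ_zero by blast
  then show ?thesis
    by (simp add: LIMSEQ_const_iff)
qed

lemma emeasure_comp_measure:
  assumes "B \<in> \<Sigma>"
  shows "emeasure (comp_measure1 \<Omega> \<Sigma> P) B = ennreal (v1 (P B))"
    and "emeasure (comp_measure2 \<Omega> \<Sigma> P) B = ennreal (v2 (P B))"
proof -
  have v: "v1 (P C) \<ge> 0" "v2 (P C) \<ge> 0" if "C \<in> \<Sigma>" for C
    using P_nonneg[OF that] by (auto simp: less_eq_hyp_def hyp_nonneg_iff)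
  have ca: "countably_additive \<Sigma> (\<lambda>B. ennreal (f (P B)))"
    if f: "bounded_linear f" and nn: "\<And>C. C \<in> \<Sigma> \<Longrightarrow> f (P C) \<ge> 0" for f
  proof (rule countably_additiveI)
    fix C :: "nat \<Rightarrow> 'a set"
    assume C: "range C \<subseteq> \<Sigma>" "disjoint_family C"
    have "(\<lambda>n. f (P (C n))) sums f (P (\<Union>n. C n))"
      using bounded_linear.sums[OF f P_countably_additive[OF C]] .
    moreover have "\<And>n. f (P (C n)) \<ge> 0"
      using C nn by auto
    ultimately show "(\<Sum>n. ennreal (f (P (C n)))) = ennreal (f (P (\<Union>n. C n)))"
      by (rule suminf_ennreal_eq[rotated])
  qed
  have p: "positive \<Sigma> (\<lambda>B. ennreal (v1 (P B)))" "positive \<Sigma> (\<lambda>B. ennreal (v2 (P B)))"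
    by (simp_all add: positive_def P_empty)
  show "emeasure (comp_measure1 \<Omega> \<Sigma> P) B = ennreal (v1 (P B))"
    unfolding comp_measure1_def
    using emeasure_measure_of_sigma[OF sigma_algebra_axioms p(1) ca[OF bounded_linear_v(1) v(1)] assms] .
  show "emeasure (comp_measure2 \<Omega> \<Sigma> P) B = ennreal (v2 (P B))"
    unfolding comp_measure2_def
    using emeasure_measure_of_sigma[OF sigma_algebra_axioms p(2) ca[OF bounded_linear_v(2) v(2)] assms] .
qed

lemma sets_comp_measure:
  "sets (comp_measure1 \<Omega> \<Sigma> P) = \<Sigma>" "sets (comp_measure2 \<Omega> \<Sigma> P) = \<Sigma>"
  by (simp_all add: comp_measure1_def comp_measure2_def sigma_sets_eq)

end

end

theory Submission imports Defs begin

text \<open>In each idempotent coordinate the claim is real-valued: a function constant on every cell of a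
  countable partition, whose constant times the mass of the cell is the integral of \<open>f\<close> over the cell,
  is integrable because \<open>\<Sum>\<^sub>n \<bar>\<integral>\<^bsub>A\<^sub>n\<^esub> f\<bar> \<le> \<integral> \<bar>f\<bar>\<close>, and then countable additivity gives the equality of
  integrals. A cell may be null in one coordinate; there the conventional value \<open>E(X)\<close> of the
  conditional expectation is multiplied by zero mass and so is irrelevant.\<close>

lemma
  fixes f g :: "'a \<Rightarrow> real" and A :: "nat \<Rightarrow> 'a set"
  assumes A: "range A \<subseteq> sets M" "disjoint_family A" "(\<Union>n. A n) = space M"
    and fin: "\<And>n. emeasure M (A n) < \<infinity>"
    and g: "\<And>n \<omega>. \<omega> \<in> A n \<Longrightarrow> g \<omega> = c n"
    and c: "\<And>n. c n * measure M (A n) = (LINT \<omega>:A n|M. f \<omega>)"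
    and f: "integrable M f"
  shows integrable_if_average_on_partition: "integrable M g"
    and set_integral_average_on_partition:
      "(LINT \<omega>:(\<Union>j\<in>J. A j)|M. g \<omega>) = (LINT \<omega>:(\<Union>j\<in>J. A j)|M. f \<omega>)"
proof -
  have sA [measurable]: "A n \<in> sets M" for n
    using A(1) by auto
  \<comment> \<open>On each of the countably many measurable cells \<open>g\<close> agrees with a
    constant function.\<close>
  have [measurable]: "g \<in> borel_measurable M"
    using g by (intro measurable_piecewise_restrict2[OF sA A(3)[symmetric]])
      (auto intro!: bexI[where x = "\<lambda>_. c _"])
  \<comment> \<open>Nonnegative integrals are used because this is applied to \<open>g\<close>
    before its integrability is known.\<close>
  have sum_abs: "(\<integral>\<^sup>+\<omega>. ennreal \<bar>h \<omega>\<bar> \<partial>M) = (\<Sum>n. \<integral>\<^sup>+\<omega>\<in>A n. ennreal \<bar>h \<omega>\<bar> \<partial>M)"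
    if "h \<in> borel_measurable M" for h
  proof -
    have "(\<integral>\<^sup>+\<omega>. ennreal \<bar>h \<omega>\<bar> \<partial>M) = (\<integral>\<^sup>+\<omega>\<in>(\<Union>n. A n). ennreal \<bar>h \<omega>\<bar> \<partial>M)"
      unfolding A(3) by (intro nn_integral_cong) auto
    also have "\<dots> = (\<Sum>n. \<integral>\<^sup>+\<omega>\<in>A n. ennreal \<bar>h \<omega>\<bar> \<partial>M)"
      using that A by (intro nn_integral_disjoint_family) auto
    finally show ?thesis .
  qed
  \<comment> \<open>As \<open>g\<close> has the constant value \<open>c n\<close> on the cell, the
    left side is the absolute value of \<open>c n * measure M (A n)\<close>, hence of the integral
    of \<open>f\<close> over \<open>A n\<close>; finiteness of the mass allows the passage from
    \<open>emeasure\<close> to \<open>measure\<close>.\<close>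
  have le: "(\<integral>\<^sup>+\<omega>\<in>A n. ennreal \<bar>g \<omega>\<bar> \<partial>M) \<le> (\<integral>\<^sup>+\<omega>\<in>A n. ennreal \<bar>f \<omega>\<bar> \<partial>M)" for n
  proof -
    have sf: "integrable M (\<lambda>\<omega>. indicator (A n) \<omega> *\<^sub>R f \<omega>)"
      using f sA by (rule integrable_mult_indicator[rotated])
    have "(\<integral>\<^sup>+\<omega>\<in>A n. ennreal \<bar>g \<omega>\<bar> \<partial>M) = (\<integral>\<^sup>+\<omega>\<in>A n. ennreal \<bar>c n\<bar> \<partial>M)"
      by (intro nn_integral_cong) (auto simp: g indicator_def)
    also have "\<dots> = ennreal \<bar>c n\<bar> * emeasure M (A n)"
      by (simp add: nn_integral_cmult)
    also have "\<dots> = ennreal \<bar>c n * measure M (A n)\<bar>"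
      using fin[of n] by (simp add: emeasure_eq_ennreal_measure abs_mult ennreal_mult)
    also have "\<dots> = ennreal \<bar>LINT \<omega>|M. indicator (A n) \<omega> *\<^sub>R f \<omega>\<bar>"
      by (simp add: c set_lebesgue_integral_def)
    also have "\<dots> \<le> (\<integral>\<^sup>+\<omega>. ennreal (norm (indicator (A n) \<omega> *\<^sub>R f \<omega>)) \<partial>M)"
      using integral_norm_bound_ennreal[OF sf] by simp
    also have "\<dots> = (\<integral>\<^sup>+\<omega>\<in>A n. ennreal \<bar>f \<omega>\<bar> \<partial>M)"
      by (intro nn_integral_cong) (auto simp: indicator_def)
    finally show ?thesis .
  qed
  show g_int: "integrable M g"
  proof (rule integrableI_bounded)
    have "(\<integral>\<^sup>+\<omega>. ennreal \<bar>g \<omega>\<bar> \<partial>M) \<le> (\<integral>\<^sup>+\<omega>. ennreal \<bar>f \<omega>\<bar> \<partial>M)"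
      using f by (simp add: sum_abs) (intro suminf_le le summableI)
    also have "\<dots> < \<infinity>"
      using f by (simp add: integrable_iff_bounded)
    finally show "(\<integral>\<^sup>+\<omega>. ennreal (norm (g \<omega>)) \<partial>M) < \<infinity>" by simp
  qed simp
  have piece: "(LINT \<omega>:A n|M. g \<omega>) = (LINT \<omega>:A n|M. f \<omega>)" for n
  proof -
    have "(LINT \<omega>:A n|M. g \<omega>) = (LINT \<omega>:A n|M. c n)"
      by (rule set_lebesgue_integral_cong) (auto simp: g)
    also have "\<dots> = c n * measure M (A n)"
      using fin[of n] by (simp add: set_integral_const)
    finally show ?thesis by (simp add: c)
  qed
  \<comment> \<open>Padding with empty sets turns the union over \<open>J\<close> into one over all
    naturals, as countable additivity requires, whether \<open>J\<close> is finite or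
    infinite.\<close>
  define B where "B n = (if n \<in> J then A n else {})" for n
  have UB: "(\<Union>j\<in>J. A j) = (\<Union>n. B n)"
    by (auto simp: B_def split: if_splits)
  have B: "B n \<in> sets M" "i \<noteq> j \<Longrightarrow> B i \<inter> B j = {}" for n i j
    using A(2) by (auto simp: B_def disjoint_family_on_def)
  have UN_int: "(LINT \<omega>:(\<Union>n. B n)|M. h \<omega>) = (\<Sum>n. LINT \<omega>:B n|M. h \<omega>)"
    if "integrable M h" for h :: "'a \<Rightarrow> real"
  proof (intro lebesgue_integral_countable_add B)
    have "(\<Union>n. B n) \<in> sets M"
      using B(1) by blast
    then show "set_integrable M (\<Union>n. B n) h"
      unfolding set_integrable_def using that by (rule integrable_mult_indicator)
  qed
  have "(LINT \<omega>:B n|M. g \<omega>) = (LINT \<omega>:B n|M. f \<omega>)" for n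
    by (simp add: B_def piece set_lebesgue_integral_def[of M "{}"])
  then show "(LINT \<omega>:(\<Union>j\<in>J. A j)|M. g \<omega>) = (LINT \<omega>:(\<Union>j\<in>J. A j)|M. f \<omega>)"
    unfolding UB UN_int[OF f] UN_int[OF g_int] by simp
qed

text \<open>Both coordinates are multiplicative and send 1 to 1, so they can be applied to
  \<open>z * inverse z = 1\<close>. On a zero divisor the identity fails: there
  \<open>inverse z\<close> is 0, while one coordinate of \<open>z\<close> is nonzero.\<close>

lemma v_inverse:
  assumes "z \<noteq> 0" "z \<notin> \<SS>\<^sub>\<D>"
  shows "v1 (inverse z) = inverse (v1 z)" and "v2 (inverse z) = inverse (v2 z)"
proof -
  have "v1 (z * inverse z) = 1" "v2 (z * inverse z) = 1"
    unfolding hyp_mult_inverse[OF assms] by simp_all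
  then show "v1 (inverse z) = inverse (v1 z)" "v2 (inverse z) = inverse (v2 z)"
    by (auto simp: inverse_unique)
qed

lemma v_hyp_integral [simp]:
  "v1 (hyp_integral \<Omega> \<Sigma> P B X) = (LINT \<omega>:B|comp_measure1 \<Omega> \<Sigma> P. v1 (X \<omega>))"
  "v2 (hyp_integral \<Omega> \<Sigma> P B X) = (LINT \<omega>:B|comp_measure2 \<Omega> \<Sigma> P. v2 (X \<omega>))"
  by (simp_all add: hyp_integral_def)

text \<open>In a coordinate where \<open>P B\<close> does not vanish, every branch of the definition
  divides by exactly that coordinate of \<open>P B\<close>. The value E(X) is only used in a
  vanishing coordinate.\<close>

lemma v_cond_exp_event_mult:
  assumes "P B > 0"
  shows "v1 (P B) \<noteq> 0 \<Longrightarrow> v1 (cond_exp_event \<Omega> \<Sigma> P B X) * v1 (P B) =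
      (LINT \<omega>:B|comp_measure1 \<Omega> \<Sigma> P. v1 (X \<omega>))" (is "?nz1 \<Longrightarrow> ?eq1")
    and "v2 (P B) \<noteq> 0 \<Longrightarrow> v2 (cond_exp_event \<Omega> \<Sigma> P B X) * v2 (P B) =
      (LINT \<omega>:B|comp_measure2 \<Omega> \<Sigma> P. v2 (X \<omega>))" (is "?nz2 \<Longrightarrow> ?eq2")
proof -
  have nn: "v1 (P B) \<ge> 0" and nz: "P B \<noteq> 0"
    using assms by (auto simp: less_hyp_def less_eq_hyp_def hyp_nonneg_iff)
  \<comment> \<open>These are the branches of the definition that remain once \<open>P B = 0\<close>
    is excluded. In the second \<open>v2 (P B)\<close> is 0, and in the third
    \<open>v1 (P B)\<close> is 0, so only one coordinate has content.\<close>
  consider "P B \<notin> \<SS>\<^sub>\<D>" | "P B \<in> \<SS>\<^sub>\<D>" "\<exists>r>0. P B = r *\<^sub>R he"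
    | "P B \<in> \<SS>\<^sub>\<D>" "\<not> (\<exists>r>0. P B = r *\<^sub>R he)" "v1 (P B) = 0"
  proof -
    have "v1 (P B) = 0 \<or> P B = v1 (P B) *\<^sub>R he" if "P B \<in> \<SS>\<^sub>\<D>"
      using that by (auto simp: zero_divisors_def)
    then show thesis
      using nn that by (metis order_le_less)
  qed
  then have "(?nz1 \<longrightarrow> ?eq1) \<and> (?nz2 \<longrightarrow> ?eq2)"
  proof cases
    case 1
    then show ?thesis
      using assms nz by (simp add: cond_exp_event_def divide_hyp_def v_inverse)
  qed (use nz in \<open>auto simp: cond_exp_event_def\<close>)
  then show "?nz1 \<Longrightarrow> ?eq1" "?nz2 \<Longrightarrow> ?eq2"
    by blast+
qed

text \<open>By disjointness at most one term of the defining series is nonzero at a given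
  point.\<close>

lemma cond_exp_partition_eq:
  assumes "disjoint_family A" "\<omega> \<in> A n"
  shows "cond_exp_partition \<Omega> \<Sigma> P A X \<omega> = cond_exp_event \<Omega> \<Sigma> P (A n) X"
proof -
  have "\<omega> \<notin> A m" if "m \<noteq> n" for m
    using assms that by (auto simp: disjoint_family_on_def)
  then have "cond_exp_partition \<Omega> \<Sigma> P A X \<omega> =
      (\<Sum>m\<in>{n}. cond_exp_event \<Omega> \<Sigma> P (A m) X * indicator (A m) \<omega>)"
    unfolding cond_exp_partition_def by (intro suminf_finite) auto
  with assms(2) show ?thesis by simp
qed

text \<open>The integrand vanishes almost everywhere. This serves the coordinate in which a cell has
  mass zero.\<close>

lemma set_integral_null_set:
  fixes f :: "'a \<Rightarrow> real"
  assumes "B \<in> null_sets M"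
  shows "(LINT \<omega>:B|M. f \<omega>) = 0"
proof -
  have "AE \<omega> in M. indicator B \<omega> *\<^sub>R f \<omega> = 0"
    using AE_not_in[OF assms] by eventually_elim simp
  then show ?thesis
    unfolding set_lebesgue_integral_def by (rule integral_eq_zero_AE)
qed

text \<open>Integrability is asserted along with the equality because the Lebesgue integral of a
  non-integrable function is 0 by convention; the equality alone would not make the left side a
  genuine integral.\<close>

theorem mainTheorem6:
  fixes \<Omega> :: "'a set" and \<Sigma> :: "'a set set" and P :: "'a set \<Rightarrow> hyp"
    and A :: "nat \<Rightarrow> 'a set" and X :: "'a \<Rightarrow> hyp" and J :: "nat set"
  assumes "hyp_prob_space \<Omega> \<Sigma> P"
    and "range A \<subseteq> \<Sigma>" and "disjoint_family A" and "(\<Union>n. A n) = \<Omega>"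
    and "\<And>n. P (A n) > 0"
    and "hyp_random_variable \<Omega> \<Sigma> X"
    and "hyp_integrable \<Omega> \<Sigma> P X"
  shows "hyp_integrable \<Omega> \<Sigma> P (cond_exp_partition \<Omega> \<Sigma> P A X) \<and>
    hyp_integral \<Omega> \<Sigma> P (\<Union>j\<in>J. A j) (cond_exp_partition \<Omega> \<Sigma> P A X) =
    hyp_integral \<Omega> \<Sigma> P (\<Union>j\<in>J. A j) X"
proof -
  interpret hyp_prob_space \<Omega> \<Sigma> P by fact
  let ?Y = "cond_exp_partition \<Omega> \<Sigma> P A X" and ?c = "\<lambda>n. cond_exp_event \<Omega> \<Sigma> P (A n) X"
  \<comment> \<open>One argument serves both coordinates: \<open>v\<close> will be \<open>v1\<close>
    or \<open>v2\<close>, and \<open>M\<close> the corresponding component measure.\<close>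
  have component: "integrable M (\<lambda>\<omega>. v (?Y \<omega>)) \<and>
      (LINT \<omega>:(\<Union>j\<in>J. A j)|M. v (?Y \<omega>)) = (LINT \<omega>:(\<Union>j\<in>J. A j)|M. v (X \<omega>))"
    if sets: "sets M = \<Sigma>" and em: "\<And>B. B \<in> \<Sigma> \<Longrightarrow> emeasure M B = ennreal (v (P B))"
      and nn: "\<And>n. v (P (A n)) \<ge> 0"
      and mult: "\<And>n. v (P (A n)) \<noteq> 0 \<Longrightarrow>
        v (?c n) * v (P (A n)) = (LINT \<omega>:A n|M. v (X \<omega>))"
      and int: "integrable M (\<lambda>\<omega>. v (X \<omega>))"
    for M and v :: "hyp \<Rightarrow> real"
  proof -
    \<comment> \<open>Both sets are the largest member of \<Sigma>.\<close>
    have space: "space M = \<Omega>"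
      using sets sets.space_closed[of M] sets.top[of M] space_closed top by blast
    have A_in: "A n \<in> \<Sigma>" for n
      using assms(2) by blast
    \<comment> \<open>On a null cell both sides are 0, whatever value the conditional expectation
      takes there; otherwise this is \<open>mult\<close>.\<close>
    have c: "v (?c n) * measure M (A n) = (LINT \<omega>:A n|M. v (X \<omega>))" for n
    proof (cases "v (P (A n)) = 0")
      case True
      then have "A n \<in> null_sets M"
        using A_in by (simp add: null_sets_def em sets)
      then show ?thesis
        by (simp add: set_integral_null_set measure_eq_0_null_sets)
    next
      case False
      then show ?thesis
        using A_in nn by (simp add: mult measure_def em)
    qed
    have fin: "emeasure M (A n) < \<infinity>" for n
      using A_in by (simp add: em)
    have Y: "v (?Y \<omega>) = v (?c n)" if "\<omega> \<in> A n" for n \<omega>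
      using cond_exp_partition_eq[OF assms(3) that] by simp
    \<comment> \<open>The open slot \<open>_\<close> is the hypothesis that the integrand is
      constant on each cell, closed by \<open>Y\<close> below.\<close>
    note average = assms(2)[folded sets] assms(3) assms(4)[folded space] fin _ c int
    show ?thesis
      by (intro conjI integrable_if_average_on_partition[OF average]
          set_integral_average_on_partition[OF average] Y)
  qed
  have nn: "v1 (P (A n)) \<ge> 0" "v2 (P (A n)) \<ge> 0" for n
    using assms(5)[of n] by (auto simp: less_hyp_def less_eq_hyp_def hyp_nonneg_iff)
  note mult = v_cond_exp_event_mult[where P = P, OF assms(5)]
  have int: "integrable (comp_measure1 \<Omega> \<Sigma> P) (\<lambda>\<omega>. v1 (X \<omega>))"
    "integrable (comp_measure2 \<Omega> \<Sigma> P) (\<lambda>\<omega>. v2 (X \<omega>))"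
    using assms(7) by (simp_all add: hyp_integrable_def)
  show ?thesis
    using component[OF sets_comp_measure(1) emeasure_comp_measure(1) nn(1) mult(1) int(1)]
      component[OF sets_comp_measure(2) emeasure_comp_measure(2) nn(2) mult(2) int(2)]
    by (simp add: hyp_integrable_def hyp_integral_def)
qed

end
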